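(* Let $0\le\alpha\le1$ and let $G$ be a connected graph of order $n$ having Wiener index $W$. Then $$D_\alpha S(G)\le \Big(2(1-\alpha)^2\sum_{i\ne j}(d_{ij})^2+2\alpha^2\sum_{i=1}^n Tr_i^2-\frac{8}{n}\alpha^2W^2\Big)^{1/2},$$ where the first sum is over all ordered pairs $(i,j)$ with $i\neq j$, with equality if and only if $\partial_2=\partial_3=\cdots=\partial_{n-1}=\frac{\partial_1+\partial_n}{2}$.
   Context: All graphs are finite, undirected and simple. For a connected graph $G$ with vertices $v_1,\dots,v_n$, $d_{ij}$ is the distance between $v_i$ and $v_j$, $D(G)=(d_{ij})$ is the distance matrix, $Tr_i=\sum_{j}d_{ij}$ is the transmission of $v_i$, $Tr(G)=\mathrm{diag}(Tr_1,\dots,Tr_n)$, and $W=\frac12\sum_i Tr_i$ is the Wiener index. For $0\le\alpha\le1$ the generalized distance matrix is $D_\alpha(G)=\alpha Tr(G)+(1-\alpha)D(G)$, with eigenvalues $\partial_1\ge\partial_2\ge\cdots\ge\partial_n$. The generalized distance spectral spread is $D_\alpha S(G)=\partial_1-\partial_n$. *)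

theory Defs
  imports "Graph_Theory.Graph_Theory" "Jordan_Normal_Form.Char_Poly"
begin

text \<open>
  Finite simple undirected graphs are the symmetric digraphs of the locale \<open>graph\<close>;
  \<open>Digraph_Component.connected\<close> includes that the vertex set is nonempty.
  With unit arc weights, \<open>wf_digraph.\<mu>\<close> is the infimum of the lengths of the walks
  between two vertices.
\<close>

definition gdist :: "('a, 'b) pre_digraph \<Rightarrow> 'a \<Rightarrow> 'a \<Rightarrow> real" where
  "gdist G u w = real_of_ereal (wf_digraph.\<mu> G (\<lambda>_. 1) u w)"

definition transmission :: "('a, 'b) pre_digraph \<Rightarrow> 'a \<Rightarrow> real" where
  "transmission G u = (\<Sum>w\<in>verts G. gdist G u w)"

definition wiener_index :: "('a, 'b) pre_digraph \<Rightarrow> real" where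
  "wiener_index G = 1 / 2 * (\<Sum>u\<in>verts G. transmission G u)"

text \<open>
  The matrices depend on an enumeration \<open>v 0, \<dots>, v (n - 1)\<close> of the vertices.
\<close>

definition distance_matrix :: "('a, 'b) pre_digraph \<Rightarrow> nat \<Rightarrow> (nat \<Rightarrow> 'a) \<Rightarrow> real mat" where
  "distance_matrix G n v = mat n n (\<lambda>(i, j). gdist G (v i) (v j))"

definition transmission_matrix :: "('a, 'b) pre_digraph \<Rightarrow> nat \<Rightarrow> (nat \<Rightarrow> 'a) \<Rightarrow> real mat" where
  "transmission_matrix G n v = mat n n (\<lambda>(i, j). if i = j then transmission G (v i) else 0)"

definition gen_distance_matrix ::
  "real \<Rightarrow> ('a, 'b) pre_digraph \<Rightarrow> nat \<Rightarrow> (nat \<Rightarrow> 'a) \<Rightarrow> real mat" where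
  "gen_distance_matrix \<alpha> G n v =
     \<alpha> \<cdot>\<^sub>m transmission_matrix G n v + (1 - \<alpha>) \<cdot>\<^sub>m distance_matrix G n v"

text \<open>
  The \<open>k\<close>-th largest eigenvalue, for \<open>k\<close> from \<open>1\<close> to \<open>n\<close>, counted with multiplicity.
  It is meant for real symmetric \<open>n \<times> n\<close> matrices, whose characteristic polynomial
  has \<open>n\<close> real roots.
\<close>

definition kth_eigenvalue :: "real mat \<Rightarrow> nat \<Rightarrow> real" where
  "kth_eigenvalue A k = rev (sorted_list_of_multiset (proots (char_poly A))) ! (k - 1)"

definition spectral_spread :: "real mat \<Rightarrow> real" where
  "spectral_spread A = kth_eigenvalue A 1 - kth_eigenvalue A (dim_row A)"

end

theory Submission
  imports Defs "Jordan_Normal_Form.Schur_Decomposition"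
begin

text \<open>
  The eigenvalues \<open>\<theta>\<^sub>k\<close> of a real symmetric matrix satisfy \<open>\<Sum>\<theta>\<^sub>k = tr A\<close> and
  \<open>\<Sum>\<theta>\<^sub>k\<^sup>2 = tr A\<^sup>2\<close>. With the mean \<open>m = tr A / n\<close>, the parallelogram law gives
  \<open>2 \<Sum>(\<theta>\<^sub>k - m)\<^sup>2 - (\<theta>\<^sub>1 - \<theta>\<^sub>n)\<^sup>2 = (\<theta>\<^sub>1 + \<theta>\<^sub>n - 2 m)\<^sup>2 + 2 \<Sum>\<^bsub>1<k<n\<^esub> (\<theta>\<^sub>k - m)\<^sup>2\<close>,
  and the right-hand side is nonnegative and vanishes iff all the middle eigenvalues
  equal \<open>(\<theta>\<^sub>1 + \<theta>\<^sub>n) / 2\<close>. For the generalized distance matrix \<open>tr A = 2 \<alpha> W\<close>.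
\<close>

section \<open>Traces and similarity\<close>

definition trace :: "'a::comm_monoid_add mat \<Rightarrow> 'a" where
  "trace A = (\<Sum>i<dim_row A. A $$ (i, i))"

lemma trace_mult:
  fixes A B :: "'a::semiring_0 mat"
  assumes "A \<in> carrier_mat n m" and "B \<in> carrier_mat m n"
  shows "trace (A * B) = (\<Sum>i<n. \<Sum>j<m. A $$ (i, j) * B $$ (j, i))"
proof -
  have "(A * B) $$ (i, i) = (\<Sum>j<m. A $$ (i, j) * B $$ (j, i))" if "i < n" for i
    using assms that by (auto simp: scalar_prod_def lessThan_atLeast0 intro!: sum.cong)
  then show ?thesis
    using assms unfolding trace_def by auto
qed

lemma trace_mult_commute:
  fixes A B :: "'a::comm_semiring_0 mat"
  assumes "A \<in> carrier_mat n m" and "B \<in> carrier_mat m n"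
  shows "trace (A * B) = trace (B * A)"
  using trace_mult[OF assms] trace_mult[OF assms(2,1)] sum.swap
  by (simp add: mult.commute) (subst sum.swap, simp add: mult.commute)

text \<open>Cyclicity moves \<open>Q\<close> to the front of \<open>P * B * Q\<close>, where it
  cancels \<open>P\<close>.\<close>

lemma trace_similar:
  fixes A B :: "'a::comm_ring_1 mat"
  assumes "similar_mat A B"
  shows "trace A = trace B"
proof -
  obtain P Q where w: "similar_mat_wit A B P Q"
    using assms unfolding similar_mat_def by blast
  obtain n where A: "A \<in> carrier_mat n n"
    using similar_matD[OF assms] by blast
  note D = similar_mat_witD2[OF A w]
  have "trace A = trace (Q * (P * B))"
    unfolding D(3) using trace_mult_commute[of "P * B" n n Q] D by simp
  also have "Q * (P * B) = B"
    using D by (simp flip: assoc_mult_mat[of Q n n P n B n])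
  finally show ?thesis .
qed

section \<open>Real spectrum of symmetric matrices\<close>

lemma eigenvalue_symmetric_real:
  fixes A :: "real mat" and e :: complex
  assumes A: "A \<in> carrier_mat n n"
    and sym: "\<And>i j. i < n \<Longrightarrow> j < n \<Longrightarrow> A $$ (i, j) = A $$ (j, i)"
    and e: "eigenvalue (map_mat complex_of_real A) e"
  shows "e \<in> \<real>"
proof -
  let ?C = "map_mat complex_of_real A"
  obtain v where v: "v \<in> carrier_vec n" "v \<noteq> 0\<^sub>v n" "?C *\<^sub>v v = e \<cdot>\<^sub>v v"
    using e A unfolding eigenvalue_def eigenvector_def by auto
  \<comment> \<open>The squared Hermitian norm of the eigenvector. Evaluating the form of
    \<open>A\<close> at \<open>v\<close> in two ways gives both \<open>e * s\<close> and
    \<open>cnj e * s\<close>; since \<open>s\<close> is nonzero, \<open>e\<close> equals its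
    conjugate.\<close>
  define s where "s = (\<Sum>i<n. v $ i * cnj (v $ i))"
  have ev: "(\<Sum>j<n. A $$ (i, j) * v $ j) = e * v $ i" if "i < n" for i
  proof -
    have "(?C *\<^sub>v v) $ i = (\<Sum>j<n. A $$ (i, j) * v $ j)"
      using that A v(1) by (auto simp: scalar_prod_def lessThan_atLeast0 intro!: sum.cong)
    then show ?thesis
      using that v by simp
  qed
  \<comment> \<open>Conjugation leaves the entries of \<open>A\<close> unchanged because they are
    real.\<close>
  have ev_cnj: "(\<Sum>j<n. A $$ (i, j) * cnj (v $ j)) = cnj e * cnj (v $ i)" if "i < n" for i
    using arg_cong[OF ev[OF that], of cnj] by simp
  have "e * s = (\<Sum>i<n. (\<Sum>j<n. A $$ (i, j) * v $ j) * cnj (v $ i))"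
    unfolding s_def sum_distrib_left by (intro sum.cong) (auto simp: ev)
  also have "\<dots> = (\<Sum>j<n. \<Sum>i<n. A $$ (i, j) * v $ j * cnj (v $ i))"
    unfolding sum_distrib_right by (rule sum.swap)
  also have "\<dots> = (\<Sum>j<n. (\<Sum>i<n. A $$ (j, i) * cnj (v $ i)) * v $ j)"
    unfolding sum_distrib_right by (intro sum.cong refl) (simp add: sym)
  also have "\<dots> = cnj e * s"
    unfolding s_def sum_distrib_left by (intro sum.cong) (auto simp: ev_cnj)
  finally have *: "e * s = cnj e * s" .
  obtain i where i: "i < n" "v $ i \<noteq> 0"
    using v(1,2) by (metis carrier_vecD eq_vecI index_zero_vec)
  have s: "s = complex_of_real (\<Sum>i<n. (cmod (v $ i))\<^sup>2)"
    unfolding s_def by (simp add: complex_norm_square del: of_real_power)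
  have "0 < (\<Sum>i<n. (cmod (v $ i))\<^sup>2)"
    using i by (intro sum_pos2[of _ i]) auto
  then have "s \<noteq> 0"
    unfolding s by (simp only: of_real_eq_0_iff)
  with * show ?thesis
    by (simp add: Reals_cnj_iff)
qed

text \<open>The characteristic polynomial splits over the complex numbers, and every root is an
  eigenvalue, hence real. The factorization descends to the reals because the embedding of real
  polynomials into complex ones is injective.\<close>

lemma char_poly_symmetric_splits:
  fixes A :: "real mat"
  assumes A: "A \<in> carrier_mat n n"
    and sym: "\<And>i j. i < n \<Longrightarrow> j < n \<Longrightarrow> A $$ (i, j) = A $$ (j, i)"
  obtains es where "char_poly A = (\<Prod>e\<leftarrow>es. [:- e, 1:])" and "length es = n"
proof -
  let ?C = "map_mat complex_of_real A"
  have C: "?C \<in> carrier_mat n n"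
    using A by simp
  obtain as where as: "char_poly ?C = (\<Prod>a\<leftarrow>as. [:- a, 1:])" "length as = n"
    using char_poly_factorized[OF C] by blast
  have real: "complex_of_real (Re a) = a" if "a \<in> set as" for a
  proof -
    have "poly (char_poly ?C) a = 0"
      unfolding as using that by (auto simp: poly_prod_list prod_list_zero_iff)
    then have "eigenvalue ?C a"
      using eigenvalue_root_char_poly[OF C] by blast
    then show ?thesis
      using eigenvalue_symmetric_real[OF A sym] of_real_Re by blast
  qed
  interpret h: map_poly_inj_idom_hom complex_of_real ..
  have "map_poly complex_of_real (\<Prod>e\<leftarrow>map Re as. [:- e, 1:]) = (\<Prod>a\<leftarrow>as. [:- a, 1:])"
    unfolding h.hom_prod_list using real
    by (auto simp: o_def map_poly_pCons intro!: arg_cong[of _ _ prod_list])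
  also have "\<dots> = map_poly complex_of_real (char_poly A)"
    using as(1) of_real_hom.char_poly_hom[OF A] by metis
  finally have "char_poly A = (\<Prod>e\<leftarrow>map Re as. [:- e, 1:])"
    using h.injectivity by metis
  with as(2) that show ?thesis
    by (metis length_map)
qed

section \<open>Power sums of the eigenvalues as traces\<close>

lemma trace_upper_triangular_square:
  fixes B :: "'a::semiring_1 mat"
  assumes B: "B \<in> carrier_mat n n" and ut: "upper_triangular B"
  shows "trace (B * B) = (\<Sum>i<n. (B $$ (i, i))\<^sup>2)"
proof -
  have "(\<Sum>j<n. B $$ (i, j) * B $$ (j, i)) = (B $$ (i, i))\<^sup>2" if "i < n" for i
  proof -
    \<comment> \<open>Off the diagonal, one of the two positions lies strictly below it, so that
      factor vanishes.\<close>
    have "B $$ (i, j) * B $$ (j, i) = (if j = i then (B $$ (i, i))\<^sup>2 else 0)" if "j < n" for j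
      using upper_triangularD[OF ut, of i j] upper_triangularD[OF ut, of j i] B \<open>i < n\<close> that
      by (cases i j rule: linorder_cases) (auto simp: power2_eq_square)
    then show ?thesis
      using that by simp
  qed
  then show ?thesis
    using trace_mult[OF B B] by simp
qed

lemma similar_mat_square:
  fixes A B :: "'a::comm_ring_1 mat"
  assumes "similar_mat A B"
  shows "similar_mat (A * A) (B * B)"
proof -
  obtain P Q where w: "similar_mat_wit A B P Q"
    using assms unfolding similar_mat_def by blast
  obtain n where A: "A \<in> carrier_mat n n"
    using similar_matD[OF assms] by blast
  note D = similar_mat_witD2[OF A w]
  show ?thesis
    using similar_mat_wit_pow[OF w, of 2] A D
    by (auto simp: similar_mat_def numeral_2_eq_2)
qed

text \<open>Schur decomposition makes \<open>A\<close> similar to an upper triangular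
  \<open>B\<close> with diagonal \<open>es\<close>, so both power sums are traces of
  \<open>B\<close> and \<open>B * B\<close>. Symmetry enters through the splitting of the
  characteristic polynomial over the reals.\<close>

lemma symmetric_eigenvalues_trace:
  fixes A :: "real mat"
  assumes A: "A \<in> carrier_mat n n"
    and sym: "\<And>i j. i < n \<Longrightarrow> j < n \<Longrightarrow> A $$ (i, j) = A $$ (j, i)"
  obtains es where "proots (char_poly A) = mset es" and "length es = n"
    and "sum_list es = trace A" and "(\<Sum>e\<leftarrow>es. e\<^sup>2) = trace (A * A)"
proof -
  obtain es where es: "char_poly A = (\<Prod>e\<leftarrow>es. [:- e, 1:])" "length es = n"
    using char_poly_symmetric_splits[OF A sym] by blast
  obtain B P Q where dec: "schur_decomposition A es = (B, P, Q)"
    by (cases "schur_decomposition A es")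
  have w: "similar_mat_wit A B P Q" and ut: "upper_triangular B" and diag: "diag_mat B = es"
    using schur_decomposition[OF A es(1) dec] by auto
  have B: "B \<in> carrier_mat n n"
    using similar_mat_witD2[OF A w] by simp
  have sim: "similar_mat A B"
    using w unfolding similar_mat_def by blast
  \<comment> \<open>Stated for an arbitrary list that shadows the fixed \<open>es\<close>, so that
    the induction is not tied to \<open>A\<close>.\<close>
  have "proots (\<Prod>e\<leftarrow>es. [:- e, 1:]) = mset es" for es :: "real list"
  proof (induction es)
    case (Cons e es)
    have "[:- e, 1:] \<noteq> 0" and "(\<Prod>e\<leftarrow>es. [:- e, 1:]) \<noteq> 0"
      by (auto simp: prod_list_zero_iff)
    then have "proots ([:- e, 1:] * (\<Prod>e\<leftarrow>es. [:- e, 1:])) = {#e#} + mset es"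
      by (simp only: proots_mult proots_linear_factor Cons.IH minus_minus not_False_eq_True)
    then show ?case
      by (simp del: mult_pCons_left)
  qed simp
  then have 1: "proots (char_poly A) = mset es"
    by (simp add: es)
  have sum_diag: "(\<Sum>e\<leftarrow>es. f e) = (\<Sum>i<n. f (B $$ (i, i)))" for f :: "real \<Rightarrow> real"
    using B unfolding diag[symmetric] diag_mat_def
    by (simp add: o_def interv_sum_list_conv_sum_set_nat lessThan_atLeast0)
  have "sum_list es = trace B"
    using sum_diag[of "\<lambda>x. x"] B by (simp add: trace_def)
  then have 2: "sum_list es = trace A"
    using trace_similar[OF sim] by simp
  have 3: "(\<Sum>e\<leftarrow>es. e\<^sup>2) = trace (A * A)"
    using sum_diag[of power2] trace_upper_triangular_square[OF B ut]
      trace_similar[OF similar_mat_square[OF sim]] by simp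
  show ?thesis
    by (rule that[OF 1 es(2) 2 3])
qed

lemma kth_eigenvalue_sums:
  fixes A :: "real mat"
  assumes A: "A \<in> carrier_mat n n"
    and sym: "\<And>i j. i < n \<Longrightarrow> j < n \<Longrightarrow> A $$ (i, j) = A $$ (j, i)"
  shows kth_eigenvalue_sum: "(\<Sum>k=1..n. kth_eigenvalue A k) = trace A"
    and kth_eigenvalue_sum_squares: "(\<Sum>k=1..n. (kth_eigenvalue A k)\<^sup>2) = trace (A * A)"
    and kth_eigenvalue_antimono:
      "\<And>k l. 1 \<le> k \<Longrightarrow> k \<le> l \<Longrightarrow> l \<le> n \<Longrightarrow> kth_eigenvalue A l \<le> kth_eigenvalue A k"
proof -
  obtain es where es: "proots (char_poly A) = mset es" "length es = n"
    "sum_list es = trace A" "(\<Sum>e\<leftarrow>es. e\<^sup>2) = trace (A * A)"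
    using symmetric_eigenvalues_trace[OF A sym] by blast
  define xs where "xs = rev (sort es)"
  have kth: "kth_eigenvalue A k = xs ! (k - 1)" for k
    unfolding kth_eigenvalue_def es(1) xs_def by simp
  have len: "length xs = n"
    by (simp add: xs_def es)
  \<comment> \<open>Such a sum depends on the multiset of eigenvalues alone, so sorting does not
    change it. It is used with the identity and with squaring.\<close>
  have sums: "(\<Sum>k=1..n. f (kth_eigenvalue A k)) = (\<Sum>e\<leftarrow>es. f e)" for f :: "real \<Rightarrow> real"
  proof -
    have "(\<Sum>k=1..n. f (kth_eigenvalue A k)) = (\<Sum>i<n. f (xs ! i))"
      unfolding kth by (rule sum.reindex_bij_witness[of _ Suc "\<lambda>k. k - 1"]) auto
    also have "\<dots> = sum_list (map f xs)"
      using len by (simp add: sum_list_sum_nth lessThan_atLeast0)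
    also have "\<dots> = sum_mset (image_mset f (mset xs))"
      by (metis mset_map sum_mset_sum_list)
    also have "\<dots> = sum_list (map f es)"
      unfolding xs_def by (simp flip: sum_mset_sum_list)
    finally show ?thesis .
  qed
  show "(\<Sum>k=1..n. kth_eigenvalue A k) = trace A"
    using sums[of "\<lambda>x. x"] es by simp
  show "(\<Sum>k=1..n. (kth_eigenvalue A k)\<^sup>2) = trace (A * A)"
    using sums[of power2] es by simp
  show "kth_eigenvalue A l \<le> kth_eigenvalue A k" if "1 \<le> k" "k \<le> l" "l \<le> n" for k l
    unfolding kth using that len sorted_rev_nth_mono[of xs "k - 1" "l - 1"]
    by (simp add: xs_def)
qed

section \<open>An inequality between spread and deviation for real sequences\<close>

lemma spread_deviation_identity:
  fixes x :: "nat \<Rightarrow> real"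
  assumes n: "2 \<le> n"
  defines "m \<equiv> (\<Sum>k=1..n. x k) / n"
  shows "2 * (\<Sum>k=1..n. (x k)\<^sup>2) - 2 / n * (\<Sum>k=1..n. x k)\<^sup>2
    = (x 1 - x n)\<^sup>2 + (x 1 + x n - 2 * m)\<^sup>2 + 2 * (\<Sum>k=2..n - 1. (x k - m)\<^sup>2)"
proof -
  have sum: "(\<Sum>k=1..n. x k) = n * m"
    using n by (simp add: m_def)
  have "(\<Sum>k=1..n. (x k - m)\<^sup>2) = (\<Sum>k=1..n. (x k)\<^sup>2) - 2 * m * (\<Sum>k=1..n. x k) + n * m\<^sup>2"
    by (simp add: power2_diff sum.distrib sum_subtractf sum_distrib_left algebra_simps)
  then have dev: "2 * (\<Sum>k=1..n. (x k)\<^sup>2) - 2 / n * (\<Sum>k=1..n. x k)\<^sup>2 = 2 * (\<Sum>k=1..n. (x k - m)\<^sup>2)"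
    unfolding sum using n by (simp add: power2_eq_square field_simps)
  \<comment> \<open>As \<open>n\<close> is at least 2, the two ends are distinct and can be split
    off; for \<open>n = 2\<close> the middle range is empty.\<close>
  have "{1..n} = insert 1 (insert n {2..n - 1})"
    using n by auto
  then have "(\<Sum>k=1..n. (x k - m)\<^sup>2) = (x 1 - m)\<^sup>2 + (x n - m)\<^sup>2 + (\<Sum>k=2..n - 1. (x k - m)\<^sup>2)"
    using n by simp
  \<comment> \<open>The parallelogram law for \<open>x 1 - m\<close> and \<open>x n - m\<close>,
    whose difference is the spread.\<close>
  then show ?thesis
    unfolding dev by (simp add: power2_eq_square algebra_simps)
qed

text \<open>This turns the vanishing of all error squares into the equality condition. If the
  \<open>n - 2\<close> middle terms equal the midpoint of the two ends, the total is
  \<open>n\<close> times that midpoint, which is therefore the mean.\<close>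

lemma middle_terms_eq_mean_iff:
  fixes x :: "nat \<Rightarrow> real"
  assumes n: "2 \<le> n"
  defines "m \<equiv> (\<Sum>k=1..n. x k) / n"
  shows "x 1 + x n = 2 * m \<and> (\<forall>k\<in>{2..n - 1}. x k = m) \<longleftrightarrow>
    (\<forall>k\<in>{2..n - 1}. x k = (x 1 + x n) / 2)"
proof
  assume mid: "\<forall>k\<in>{2..n - 1}. x k = (x 1 + x n) / 2"
  have "{1..n} = insert 1 (insert n {2..n - 1})"
    using n by auto
  then have "(\<Sum>k=1..n. x k) = x 1 + x n + (\<Sum>k=2..n - 1. x k)"
    using n by simp
  also have "(\<Sum>k=2..n - 1. x k) = (\<Sum>k=2..n - 1. (x 1 + x n) / 2)"
    using mid by (intro sum.cong refl) blast
  also have "\<dots> = (real n - 2) * ((x 1 + x n) / 2)"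
    using n by (simp add: of_nat_diff)
  finally have "x 1 + x n = 2 * m"
    using n by (simp add: m_def field_simps)
  with mid show "x 1 + x n = 2 * m \<and> (\<forall>k\<in>{2..n - 1}. x k = m)"
    by simp
qed auto

lemma spread_le_sqrt_deviation:
  fixes x :: "nat \<Rightarrow> real"
  assumes n: "1 \<le> n" and ord: "x n \<le> x 1"
  defines "S \<equiv> 2 * (\<Sum>k=1..n. (x k)\<^sup>2) - 2 / n * (\<Sum>k=1..n. x k)\<^sup>2"
  shows "x 1 - x n \<le> sqrt S \<and>
    (x 1 - x n = sqrt S \<longleftrightarrow> (\<forall>k\<in>{2..n - 1}. x k = (x 1 + x n) / 2))"
proof (cases "n = 1")
  \<comment> \<open>A single term has spread 0 and \<open>S = 0\<close>, and
    \<open>{2..n - 1}\<close> is empty, so equality and its condition both hold.\<close>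
  case True
  then show ?thesis
    by (simp add: S_def)
next
  case False
  with n have n2: "2 \<le> n"
    by simp
  define m where "m = (\<Sum>k=1..n. x k) / n"
  define R where "R = (\<Sum>k=2..n - 1. (x k - m)\<^sup>2)"
  have S: "S = (x 1 - x n)\<^sup>2 + (x 1 + x n - 2 * m)\<^sup>2 + 2 * R"
    unfolding S_def R_def m_def by (rule spread_deviation_identity[OF n2])
  have R: "0 \<le> R"
    unfolding R_def by (intro sum_nonneg) simp
  have R0: "R = 0 \<longleftrightarrow> (\<forall>k\<in>{2..n - 1}. x k = m)"
    unfolding R_def by (subst sum_nonneg_eq_0_iff) auto
  have le: "(x 1 - x n)\<^sup>2 \<le> S"
    unfolding S using R by simp
  have "0 \<le> S"
    using order_trans[OF zero_le_power2 le] .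
  \<comment> \<open>Squaring is reversible here: \<open>ord\<close> makes the spread
    nonnegative.\<close>
  then have "x 1 - x n = sqrt S \<longleftrightarrow> (x 1 - x n)\<^sup>2 = S"
    using ord real_sqrt_unique[of "x 1 - x n" S] by auto
  also have "\<dots> \<longleftrightarrow> x 1 + x n = 2 * m \<and> R = 0"
    unfolding S using R by (auto simp: add_nonneg_eq_0_iff)
  finally show ?thesis
    using real_le_rsqrt[OF le] middle_terms_eq_mean_iff[OF n2, of x] R0 unfolding m_def by simp
qed

section \<open>Symmetry and vanishing of the graph distance\<close>

lemma (in sym_digraph) awalk_reverse:
  assumes "awalk u p w"
  obtains q where "awalk w q u" and "length q = length p"
proof -
  have "\<exists>q. awalk w q u \<and> length q = length p"
    using assms
  proof (induction p arbitrary: u)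
    case Nil
    then show ?case
      by (auto simp: awalk_Nil_iff intro!: exI[of _ "[]"])
  next
    case (Cons a p)
    then have a: "a \<in> arcs G" "tail G a = u" and p: "awalk (head G a) p w"
      by (auto simp: awalk_Cons_iff)
    obtain q where q: "awalk w q (head G a)" "length q = length p"
      using Cons.IH[OF p] by blast
    \<comment> \<open>Arcs are directed, so reversing the arc list is not enough: each arc is
      replaced by an opposite one, which symmetry supplies.\<close>
    obtain b where b: "b \<in> arcs G" "tail G a = head G b" "head G a = tail G b"
      using sym_arcs a(1) unfolding symmetric_conv by blast
    have "awalk (head G a) [b] u"
      using a b by (auto simp: awalk_simps)
    then have "awalk w (q @ [b]) u"
      using q(1) by auto
    with q(2) show ?case
      by (intro exI[of _ "q @ [b]"]) simp
  qed
  with that show ?thesis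
    by blast
qed

lemma (in wf_digraph) awalk_cost_unit: "awalk_cost (\<lambda>_. 1) p = real (length p)"
  by (induction p) auto

text \<open>Reversal preserves length, so each walk one way is matched by an equally cheap walk the
  other way. This makes the distance matrix symmetric.\<close>

lemma (in sym_digraph) \<mu>_unit_commute: "\<mu> (\<lambda>_. 1) u w = \<mu> (\<lambda>_. 1) w u"
proof -
  have le: "\<mu> (\<lambda>_. 1) u w \<le> \<mu> (\<lambda>_. 1) w u" for u w
    unfolding \<mu>_def
  proof (rule INF_mono, clarify)
    fix p
    assume "awalk w p u"
    then obtain q where "awalk u q w" "length q = length p"
      by (rule awalk_reverse)
    then show "\<exists>q\<in>{q. awalk u q w}. ereal (awalk_cost (\<lambda>_. 1) q) \<le> ereal (awalk_cost (\<lambda>_. 1) p)"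
      by (auto simp: awalk_cost_unit)
  qed
  show ?thesis
    by (rule antisym[OF le le])
qed

lemma (in wf_digraph) \<mu>_unit_self:
  assumes "u \<in> verts G"
  shows "\<mu> (\<lambda>_. 1) u u = 0"
proof (rule antisym)
  show "\<mu> (\<lambda>_. 1) u u \<le> 0"
    using min_cost_le_walk_cost[of u "[]" u "\<lambda>_. 1"] assms
    by (simp add: awalk_Nil_iff zero_ereal_def)
  show "0 \<le> \<mu> (\<lambda>_. 1) u u"
    unfolding \<mu>_def by (rule INF_greatest) (simp add: awalk_cost_unit)
qed

lemma gdist_commute: "sym_digraph G \<Longrightarrow> gdist G u w = gdist G w u"
  unfolding gdist_def by (simp add: sym_digraph.\<mu>_unit_commute[of G u w])

lemma gdist_self: "wf_digraph G \<Longrightarrow> u \<in> verts G \<Longrightarrow> gdist G u u = 0"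
  unfolding gdist_def by (simp add: wf_digraph.\<mu>_unit_self)

section \<open>Entries and traces of the generalized distance matrix\<close>

lemma gen_distance_matrix_carrier: "gen_distance_matrix \<alpha> G n v \<in> carrier_mat n n"
  by (simp add: gen_distance_matrix_def transmission_matrix_def distance_matrix_def)

text \<open>The two summands have disjoint supports, since the distance of a vertex to itself is
  0.\<close>

lemma gen_distance_matrix_index:
  assumes "wf_digraph G" and "v ` {..<n} \<subseteq> verts G" and "i < n" and "j < n"
  shows "gen_distance_matrix \<alpha> G n v $$ (i, j) =
    (if i = j then \<alpha> * transmission G (v i) else (1 - \<alpha>) * gdist G (v i) (v j))"
proof -
  have "gdist G (v i) (v i) = 0"
    using assms by (intro gdist_self) auto
  then show ?thesis
    using assms
    by (auto simp: gen_distance_matrix_def transmission_matrix_def distance_matrix_def)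
qed

lemma trace_gen_distance_matrix:
  assumes "wf_digraph G" and bij: "bij_betw v {..<n} (verts G)"
  shows "trace (gen_distance_matrix \<alpha> G n v) = 2 * \<alpha> * wiener_index G"
proof -
  have "v ` {..<n} \<subseteq> verts G"
    using bij by (simp add: bij_betw_def)
  then have "trace (gen_distance_matrix \<alpha> G n v) = (\<Sum>i<n. \<alpha> * transmission G (v i))"
    using gen_distance_matrix_carrier[of \<alpha> G n v] gen_distance_matrix_index[OF assms(1)]
    by (auto simp: trace_def intro!: sum.cong)
  also have "\<dots> = \<alpha> * (\<Sum>u\<in>verts G. transmission G u)"
    unfolding sum_distrib_left using bij by (rule sum.reindex_bij_betw)
  finally show ?thesis
    by (simp add: wiener_index_def)
qed

lemma trace_gen_distance_matrix_square:
  assumes G: "sym_digraph G" and vs: "v ` {..<n} \<subseteq> verts G"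
  shows "trace (gen_distance_matrix \<alpha> G n v * gen_distance_matrix \<alpha> G n v) =
    (1 - \<alpha>)\<^sup>2 * (\<Sum>(i, j) | i < n \<and> j < n \<and> i \<noteq> j. (gdist G (v i) (v j))\<^sup>2)
    + \<alpha>\<^sup>2 * (\<Sum>i<n. (transmission G (v i))\<^sup>2)"
proof -
  let ?A = "gen_distance_matrix \<alpha> G n v"
  let ?d = "\<lambda>i j. gdist G (v i) (v j)"
  have wf: "wf_digraph G"
    using G by (simp add: sym_digraph_def)
  have "trace (?A * ?A) = (\<Sum>i<n. \<Sum>j<n. ?A $$ (i, j) * ?A $$ (j, i))"
    by (rule trace_mult) (rule gen_distance_matrix_carrier)+
  \<comment> \<open>By symmetry each product of opposite entries is a square; diagonal and
    off-diagonal parts are separated.\<close>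
  also have "\<dots> = (\<Sum>i<n. \<Sum>j<n. (if i = j then \<alpha>\<^sup>2 * (transmission G (v i))\<^sup>2 else 0)
      + (if i \<noteq> j then (1 - \<alpha>)\<^sup>2 * (?d i j)\<^sup>2 else 0))"
    by (intro sum.cong refl)
      (auto simp: gen_distance_matrix_index[OF wf vs] gdist_commute[OF G] power2_eq_square)
  also have "\<dots> = \<alpha>\<^sup>2 * (\<Sum>i<n. (transmission G (v i))\<^sup>2)
      + (\<Sum>i<n. \<Sum>j<n. if i \<noteq> j then (1 - \<alpha>)\<^sup>2 * (?d i j)\<^sup>2 else 0)"
    by (simp add: sum.distrib sum_distrib_left)
  also have "(\<Sum>i<n. \<Sum>j<n. if i \<noteq> j then (1 - \<alpha>)\<^sup>2 * (?d i j)\<^sup>2 else 0)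
      = (\<Sum>(i, j)\<in>{..<n} \<times> {..<n}. if i \<noteq> j then (1 - \<alpha>)\<^sup>2 * (?d i j)\<^sup>2 else 0)"
    by (simp add: sum.cartesian_product)
  also have "\<dots> = (\<Sum>(i, j) | i < n \<and> j < n \<and> i \<noteq> j. (1 - \<alpha>)\<^sup>2 * (?d i j)\<^sup>2)"
    by (rule sum.mono_neutral_cong_right) auto
  also have "\<dots> = (1 - \<alpha>)\<^sup>2 * (\<Sum>(i, j) | i < n \<and> j < n \<and> i \<noteq> j. (?d i j)\<^sup>2)"
    by (simp add: sum_distrib_left case_prod_unfold)
  finally show ?thesis
    by simp
qed

theorem theorem2p10:
  fixes G :: "('a, 'b) pre_digraph" and v :: "nat \<Rightarrow> 'a" and n :: nat and \<alpha> W :: real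
    and \<theta> :: "nat \<Rightarrow> real"
  assumes "graph G" and "Digraph_Component.connected G"
    and "bij_betw v {..<n} (verts G)"
    and "0 \<le> \<alpha>" and "\<alpha> \<le> 1"
    and "W = wiener_index G"
    and "\<And>k. \<theta> k = kth_eigenvalue (gen_distance_matrix \<alpha> G n v) k"
  shows "spectral_spread (gen_distance_matrix \<alpha> G n v)
         \<le> sqrt (2 * (1 - \<alpha>)\<^sup>2 * (\<Sum>(i, j) | i < n \<and> j < n \<and> i \<noteq> j. (gdist G (v i) (v j))\<^sup>2)
                + 2 * \<alpha>\<^sup>2 * (\<Sum>i<n. (transmission G (v i))\<^sup>2)
                - 8 / real n * \<alpha>\<^sup>2 * W\<^sup>2)
       \<and> (spectral_spread (gen_distance_matrix \<alpha> G n v)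
         = sqrt (2 * (1 - \<alpha>)\<^sup>2 * (\<Sum>(i, j) | i < n \<and> j < n \<and> i \<noteq> j. (gdist G (v i) (v j))\<^sup>2)
                + 2 * \<alpha>\<^sup>2 * (\<Sum>i<n. (transmission G (v i))\<^sup>2)
                - 8 / real n * \<alpha>\<^sup>2 * W\<^sup>2)
         \<longleftrightarrow> (\<forall>k\<in>{2..n - 1}. \<theta> k = (\<theta> 1 + \<theta> n) / 2))"
proof -
  let ?A = "gen_distance_matrix \<alpha> G n v"
  interpret graph G
    by fact
  have G: "sym_digraph G" and wf: "wf_digraph G"
    by unfold_locales
  have vs: "v ` {..<n} \<subseteq> verts G"
    using assms(3) by (simp add: bij_betw_def)
  \<comment> \<open>Connectedness gives a vertex, hence \<open>1 \<le> n\<close>: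
    \<open>\<theta> 1\<close> and \<open>\<theta> n\<close> are then genuine eigenvalues and the
    mean divides by a nonzero number.\<close>
  have "verts G \<noteq> {}"
    using assms(2) unfolding connected_def strongly_connected_def by simp
  then have n: "1 \<le> n"
    using assms(3) by (cases n) (auto simp: bij_betw_def)
  have A: "?A \<in> carrier_mat n n"
    by (rule gen_distance_matrix_carrier)
  have sym: "?A $$ (i, j) = ?A $$ (j, i)" if "i < n" "j < n" for i j
    using that by (simp add: gen_distance_matrix_index[OF wf vs] gdist_commute[OF G])
  have \<theta>: "\<theta> = kth_eigenvalue ?A"
    using assms(7) by blast
  have ord: "\<theta> n \<le> \<theta> 1"
    unfolding \<theta> using kth_eigenvalue_antimono[OF A sym] n by simp
  have spread: "spectral_spread ?A = \<theta> 1 - \<theta> n"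
    using A by (simp add: spectral_spread_def \<theta>)
  have "2 * (\<Sum>k=1..n. (\<theta> k)\<^sup>2) - 2 / n * (\<Sum>k=1..n. \<theta> k)\<^sup>2 =
      2 * trace (?A * ?A) - 2 / n * (trace ?A)\<^sup>2"
    unfolding \<theta> using kth_eigenvalue_sum[OF A sym] kth_eigenvalue_sum_squares[OF A sym] by simp
  \<comment> \<open>The constant 8 arises from the factor \<open>2 / n\<close> times the square of
    the trace \<open>2 * \<alpha> * W\<close>.\<close>
  also have "\<dots> = 2 * (1 - \<alpha>)\<^sup>2 * (\<Sum>(i, j) | i < n \<and> j < n \<and> i \<noteq> j. (gdist G (v i) (v j))\<^sup>2)
                + 2 * \<alpha>\<^sup>2 * (\<Sum>i<n. (transmission G (v i))\<^sup>2)
                - 8 / real n * \<alpha>\<^sup>2 * W\<^sup>2"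
    unfolding trace_gen_distance_matrix[OF wf assms(3)]
      trace_gen_distance_matrix_square[OF G vs] assms(6)
    by (simp add: power_mult_distrib algebra_simps)
  finally show ?thesis
    using spread_le_sqrt_deviation[of n \<theta>, OF n ord] unfolding spread by simp
qed

end
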